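(* For all admissible $n\geq 50$ (that is, all even integers $n\geq 50$), there exists a uniquely $2$-colourable $4$-cycle decomposition of the cocktail party graph $K_n-I$, where $I$ is a $1$-factor on the $n$ vertices.
   Context: A $4$-cycle decomposition of a graph $G$ is a family of cycles of length $4$ in $G$ such that every edge of $G$ appears in exactly one of the cycles. A $1$-factor $I$ on $n$ vertices ($n$ even) is a perfect matching of $K_n$, and the cocktail party graph $K_n-I$ is obtained from $K_n$ by removing the edges of $I$. A $4$-cycle decomposition of $K_n-I$ exists if and only if $n\ge 2$ is even, and such $n$ are called admissible. A $k$-colouring of a cycle decomposition $\mathcal{D}$ of $G$ is a map $\varphi:V(G)\to\{c_1,\ldots,c_k\}$ (not required to be surjective) such that no cycle of $\mathcal{D}$ is monochromatic, i.e. $|\varphi(V(C))|>1$ for all $C\in\mathcal{D}$. A decomposition $\mathcal{D}$ is uniquely $k$-colourable if it has a $k$-colouring $\varphi$ and for every $k$-colouring $\psi$ of $\mathcal{D}$ there is a permutation $\sigma$ of the set of colours with $\varphi=\sigma\circ\psi$ (i.e. all $k$-colourings yield the same family of colour classes). *)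

theory Defs
  imports Main "HOL-Combinatorics.Permutations"
begin

text \<open>
  A finite simple graph is given by its vertex set \<open>V\<close> and its set \<open>E\<close> of edges, an edge being a
  two-element subset of \<open>V\<close>.
\<close>

definition complete_edges :: "'a set \<Rightarrow> 'a set set" where
  "complete_edges V = {e. e \<subseteq> V \<and> card e = 2}"

definition one_factor :: "'a set \<Rightarrow> 'a set set \<Rightarrow> bool" where
  "one_factor V I \<longleftrightarrow> I \<subseteq> complete_edges V \<and> (\<forall>v\<in>V. \<exists>!e. e \<in> I \<and> v \<in> e)"

definition cocktail_party_edges :: "'a set \<Rightarrow> 'a set set \<Rightarrow> 'a set set" where
  "cocktail_party_edges V I = complete_edges V - I"

text \<open>
  A cycle is represented by its edge set \<open>C\<close>, so its vertex set \<open>V(C)\<close> is \<open>\<Union>C\<close>.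
\<close>

definition four_cycle :: "'a set set \<Rightarrow> bool" where
  "four_cycle C \<longleftrightarrow>
     (\<exists>a b c d. distinct [a, b, c, d] \<and> C = {{a, b}, {b, c}, {c, d}, {d, a}})"

text \<open>
  The cycles of a decomposition are pairwise edge-disjoint, so a family of cycles is no more
  general than a set of cycles here.
\<close>

definition four_cycle_decomposition :: "'a set set \<Rightarrow> 'a set set set \<Rightarrow> bool" where
  "four_cycle_decomposition E D \<longleftrightarrow>
     (\<forall>C\<in>D. four_cycle C \<and> C \<subseteq> E) \<and> (\<forall>e\<in>E. \<exists>!C. C \<in> D \<and> e \<in> C)"

text \<open>
  The colours are \<open>1, \<dots>, k\<close>. Only the values of a colouring on \<open>V\<close> matter.
\<close>

definition colouring :: "nat \<Rightarrow> 'a set \<Rightarrow> 'a set set set \<Rightarrow> ('a \<Rightarrow> nat) \<Rightarrow> bool" where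
  "colouring k V D \<phi> \<longleftrightarrow> \<phi> ` V \<subseteq> {1..k} \<and> (\<forall>C\<in>D. card (\<phi> ` \<Union>C) > 1)"

definition uniquely_colourable :: "nat \<Rightarrow> 'a set \<Rightarrow> 'a set set set \<Rightarrow> bool" where
  "uniquely_colourable k V D \<longleftrightarrow>
     (\<exists>\<phi>. colouring k V D \<phi> \<and>
        (\<forall>\<psi>. colouring k V D \<psi> \<longrightarrow>
           (\<exists>\<sigma>. \<sigma> permutes {1..k} \<and> (\<forall>v\<in>V. \<phi> v = \<sigma> (\<psi> v)))))"

end

(* Call a cycle of a decomposition redundant if the other cycles alone already determine the
   2-colouring, up to swapping the colours.  Suppose that (x, y, z, w) is redundant and coloured
   1, 1, 1, 2.  Add a new pair u, u' and join it to the old vertices by the cycles (u, a, u', b),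
   where {a, b} runs over the edges of any perfect matching of the old vertices that contains
   {x, z}, another pair {r, s} of colour 1 and a pair {p, q} of colour 2.  Trade
   (x, y, z, w), (u, x, u', z) for (u, x, y, z), (u', x, w, z), which use the same edges.
   The cycle (u, x, y, z) forces u to have colour 2, then (u, p, u', q) forces u' to have colour 1.
   The cycle (r, u', s, u) is coloured 1, 1, 1, 2 and is redundant, so the step can be repeated.
   It starts from a decomposition on 22 vertices that was found by a computer search. *)

theory Submission
  imports Defs "HOL-Library.Disjoint_Sets"
begin

section \<open>Four-cycles and decompositions\<close>

definition quad :: "'a \<Rightarrow> 'a \<Rightarrow> 'a \<Rightarrow> 'a \<Rightarrow> 'a set set" where
  "quad a b c d = {{a, b}, {b, c}, {c, d}, {d, a}}"

text \<open>The edge set of the complete bipartite graph between \<open>{u, u'}\<close> and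
  \<open>W\<close>, provided \<open>u\<close> and \<open>u'\<close> lie outside
  \<open>W\<close>.\<close>

definition spokes :: "'a \<Rightarrow> 'a \<Rightarrow> 'a set \<Rightarrow> 'a set set" where
  "spokes u u' W = {{t, v} | t v. t \<in> {u, u'} \<and> v \<in> W}"

lemma four_cycle_quad: "distinct [a, b, c, d] \<Longrightarrow> four_cycle (quad a b c d)"
  unfolding four_cycle_def quad_def by blast

lemma Union_quad: "\<Union> (quad a b c d) = {a, b, c, d}"
  by (auto simp: quad_def)

lemma image_quad: "(`) f ` quad a b c d = quad (f a) (f b) (f c) (f d)"
  by (simp add: quad_def)

lemma four_cycle_image:
  assumes "four_cycle C" "inj_on f (\<Union> C)"
  shows "four_cycle ((`) f ` C)"
proof -
  obtain a b c d where C: "distinct [a, b, c, d]" "C = quad a b c d"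
    using assms(1) by (auto simp: four_cycle_def quad_def)
  then have "distinct [f a, f b, f c, f d]"
    using assms(2) by (auto simp: Union_quad inj_on_def)
  then show ?thesis
    by (simp add: C image_quad four_cycle_quad)
qed

text \<open>The complete bipartite graph with two vertices on either side is a 4-cycle.\<close>

lemma spokes_pair: "spokes u u' {a, b} = quad a u b u'"
  by (auto simp: spokes_def quad_def insert_commute)

lemma spokes_Un: "spokes u u' (A \<union> B) = spokes u u' A \<union> spokes u u' B"
  by (auto simp: spokes_def)

lemma disjnt_spokes:
  assumes "disjnt W X" "u \<notin> W \<union> X" "u' \<notin> W \<union> X"
  shows "disjnt (spokes u u' W) (spokes u u' X)"
  using assms by (auto simp: disjnt_iff spokes_def doubleton_eq_iff)

text \<open>Each spoke has exactly one end in \<open>W\<close>, so disjoint blocks have disjoint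
  spokes. With \<open>spokes_pair\<close>, a perfect matching of \<open>W\<close> thus splits all
  the spokes into 4-cycles.\<close>

lemma partition_on_spokes:
  assumes M: "partition_on W M" and "u \<notin> W" "u' \<notin> W"
  shows "partition_on (spokes u u' W) (spokes u u' ` M)"
proof -
  have W: "W = \<Union> M" and ne: "{} \<notin> M"
    using M by (auto dest: partition_onD1 partition_onD3)
  have "partition_on (spokes u u' W) (spokes u u' ` M - {{}})"
  proof (rule partition_on_transform[OF M])
    show "\<Union> (spokes u u' ` M) = spokes u u' (\<Union> M)"
      by (auto simp: spokes_def)
    show "disjnt (spokes u u' p) (spokes u u' q)" if "p \<in> M" "q \<in> M" "disjnt p q" for p q
      using that assms W by (intro disjnt_spokes) auto
  qed
  moreover have "{} \<notin> spokes u u' ` M"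
    using ne by (fastforce simp: spokes_def)
  ultimately show ?thesis by simp
qed

lemma partition_on_Un:
  assumes "partition_on A P" "partition_on B Q" "disjnt A B"
  shows "partition_on (A \<union> B) (P \<union> Q)"
proof (rule partition_onI)
  have AB: "A = \<Union> P" "B = \<Union> Q"
    using assms(1,2) by (auto dest: partition_onD1)
  then show "\<Union> (P \<union> Q) = A \<union> B" by auto
  show "{} \<notin> P \<union> Q" using assms(1,2) by (auto dest: partition_onD3)
  show "disjnt p q" if pq: "p \<in> P \<union> Q" "q \<in> P \<union> Q" "p \<noteq> q" for p q
  proof -
    consider "p \<in> P" "q \<in> P" | "p \<in> Q" "q \<in> Q" | "p \<subseteq> A" "q \<subseteq> B" | "p \<subseteq> B" "q \<subseteq> A"
      using pq(1,2) AB by blast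
    then show ?thesis
    proof cases
      case 1
      then show ?thesis using assms(1) pq(3) by (auto dest: partition_onD2 pairwiseD)
    next
      case 2
      then show ?thesis using assms(2) pq(3) by (auto dest: partition_onD2 pairwiseD)
    qed (use assms(3) in \<open>auto simp: disjnt_iff\<close>)
  qed
qed

text \<open>Lying in exactly one cycle means that the cycles cover the edges and are disjoint; no
  4-cycle is empty. In this form decompositions can be cut and glued as partitions.\<close>

lemma four_cycle_decomposition_iff:
  "four_cycle_decomposition E D \<longleftrightarrow> (\<forall>C\<in>D. four_cycle C) \<and> partition_on E D"
proof
  assume D: "four_cycle_decomposition E D"
  have "partition_on E D"
  proof (rule partition_onI)
    show "\<Union> D = E" using D by (fastforce simp: four_cycle_decomposition_def)
    show "{} \<notin> D"
      using D by (auto simp: four_cycle_decomposition_def four_cycle_def)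
    show "disjnt p p'" if "p \<in> D" "p' \<in> D" "p \<noteq> p'" for p p'
      using D that unfolding four_cycle_decomposition_def disjnt_iff by blast
  qed
  then show "(\<forall>C\<in>D. four_cycle C) \<and> partition_on E D"
    using D by (simp add: four_cycle_decomposition_def)
next
  assume D: "(\<forall>C\<in>D. four_cycle C) \<and> partition_on E D"
  then have E: "E = \<Union> D" and disj: "disjoint D"
    by (auto dest: partition_onD1 partition_onD2)
  have "\<exists>!C. C \<in> D \<and> e \<in> C" if "e \<in> E" for e
  proof -
    obtain C where "C \<in> D" "e \<in> C" using \<open>e \<in> E\<close> E by blast
    moreover have "C' = C" if "C' \<in> D \<and> e \<in> C'" for C'
      using disjointD[OF disj] \<open>C \<in> D\<close> \<open>e \<in> C\<close> that by blast
    ultimately show ?thesis by blast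
  qed
  then show "four_cycle_decomposition E D"
    using D E by (auto simp: four_cycle_decomposition_def)
qed

section \<open>Renaming the vertices by an injective map\<close>

lemma inj_on_image_complete_edges:
  assumes "inj_on f V"
  shows "inj_on ((`) f) (complete_edges V)"
  using inj_on_image_Pow[OF assms] by (rule inj_on_subset) (auto simp: complete_edges_def)

lemma image_complete_edges:
  assumes "inj_on f V"
  shows "(`) f ` complete_edges V = complete_edges (f ` V)"
proof (rule set_eqI)
  fix e
  show "e \<in> (`) f ` complete_edges V \<longleftrightarrow> e \<in> complete_edges (f ` V)"
  proof
    assume "e \<in> complete_edges (f ` V)"
    then obtain A where A: "A \<subseteq> V" "e = f ` A" and "card e = 2"
      by (auto simp: complete_edges_def subset_image_iff)
    then have "A \<in> complete_edges V"
      using card_image[OF inj_on_subset[OF assms A(1)]] by (simp add: complete_edges_def)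
    then show "e \<in> (`) f ` complete_edges V" using A by blast
  next
    assume "e \<in> (`) f ` complete_edges V"
    then show "e \<in> complete_edges (f ` V)"
      using card_image inj_on_subset[OF assms] by (fastforce simp: complete_edges_def)
  qed
qed

lemma image_cocktail_party_edges:
  assumes "inj_on f V" "I \<subseteq> complete_edges V"
  shows "(`) f ` cocktail_party_edges V I = cocktail_party_edges (f ` V) ((`) f ` I)"
  unfolding cocktail_party_edges_def image_complete_edges[OF assms(1), symmetric]
  by (rule inj_on_image_set_diff[OF inj_on_image_complete_edges[OF assms(1)]]) (use assms(2) in auto)

lemma four_cycle_decomposition_image:
  assumes "four_cycle_decomposition (cocktail_party_edges V I) D" "inj_on f V"
    "I \<subseteq> complete_edges V"
  shows "four_cycle_decomposition (cocktail_party_edges (f ` V) ((`) f ` I)) ((`) ((`) f) ` D)"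
proof -
  let ?E = "cocktail_party_edges V I"
  have D: "\<And>C. C \<in> D \<Longrightarrow> four_cycle C" "partition_on ?E D"
    using assms(1) by (auto simp: four_cycle_decomposition_iff)
  have "inj_on ((`) f) ?E"
    by (rule inj_on_subset[OF inj_on_image_complete_edges[OF assms(2)]])
      (auto simp: cocktail_party_edges_def)
  from partition_on_inj_image[OF D(2) this]
  have "partition_on (cocktail_party_edges (f ` V) ((`) f ` I)) ((`) ((`) f) ` D - {{}})"
    by (simp add: image_cocktail_party_edges[OF assms(2,3)])
  moreover have "{} \<notin> (`) ((`) f) ` D"
    using partition_onD3[OF D(2)] by auto
  moreover have "four_cycle ((`) f ` C)" if "C \<in> D" for C
  proof (rule four_cycle_image[OF D(1)[OF that]])
    have "\<Union> C \<subseteq> V"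
      using that partition_onD1[OF D(2)]
      by (fastforce simp: cocktail_party_edges_def complete_edges_def)
    then show "inj_on f (\<Union> C)" by (rule inj_on_subset[OF assms(2)])
  qed
  ultimately show ?thesis by (auto simp: four_cycle_decomposition_iff)
qed

section \<open>Perfect matchings\<close>

text \<open>Split off any two elements and recurse. This completes the three prescribed pairs to a
  perfect matching in \<open>extensible_insert_pair\<close>.\<close>

lemma ex_partition_into_pairs:
  assumes "finite W" "even (card W)"
  shows "\<exists>M. partition_on W M \<and> (\<forall>e\<in>M. card e = 2)"
  using assms
proof (induction "card W" arbitrary: W rule: less_induct)
  case less
  show ?case
  proof (cases "card W = 0")
    case True
    then have "W = {}" using less.prems by simp
    then show ?thesis by (intro exI[of _ "{}"]) (simp add: partition_on_def)
  next
    case False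
    then have "2 \<le> card W" using less.prems by presburger
    then obtain e where e: "e \<subseteq> W" "card e = 2" by (metis obtain_subset_with_card_n)
    have c: "card (W - e) = card W - 2"
      using e less.prems(1) by (simp add: card_Diff_subset finite_subset)
    then have "card (W - e) < card W" "even (card (W - e))"
      using False less.prems \<open>2 \<le> card W\<close> by auto
    then obtain M where M: "partition_on (W - e) M" "\<forall>e\<in>M. card e = 2"
      using less.hyps less.prems(1) by blast
    have "partition_on W (insert e M)"
      using e M(1) partition_onD1[OF M(1)] by (subst partition_on_insert) (auto simp: disjnt_iff)
    then show ?thesis using M(2) e(2) by blast
  qed
qed

text \<open>With this numbering, passing from \<open>m\<close> to \<open>m + 1\<close> only adds the
  pair \<open>{2 * m, 2 * m + 1}\<close>, which suits the induction in
  \<open>ex_extensible\<close>.\<close>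

definition standard_factor :: "nat \<Rightarrow> nat set set" where
  "standard_factor m = (\<lambda>i. {2 * i, 2 * i + 1}) ` {..<m}"

lemma standard_factor_subset: "standard_factor m \<subseteq> complete_edges {..<2 * m}"
  by (auto simp: standard_factor_def complete_edges_def)

text \<open>All 1-factors on equally many vertices are isomorphic: remove one edge with its two
  ends, number the rest by induction, and give the last two numbers to the removed ends.\<close>

lemma one_factor_standard:
  assumes "one_factor V I" "finite V" "card V = 2 * m"
  shows "\<exists>f. bij_betw f {..<2 * m} V \<and> (`) f ` standard_factor m = I"
  using assms
proof (induction m arbitrary: V I)
  case 0
  then show ?case
    by (auto simp: one_factor_def complete_edges_def standard_factor_def bij_betw_def)
next
  case (Suc m)
  then obtain v where "v \<in> V" by fastforce
  then obtain e where e: "e \<in> I" using Suc.prems(1) by (auto simp: one_factor_def)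
  then obtain a b where ab: "e = {a, b}" "a \<noteq> b" "a \<in> V" "b \<in> V"
    using Suc.prems(1) by (auto simp: one_factor_def complete_edges_def card_2_iff)
  \<comment> \<open>No other edge of \<open>I\<close> meets \<open>e\<close>, so the remaining edges
    stay inside \<open>V - e\<close>.\<close>
  have disj: "e' = e" if "e' \<in> I" "a \<in> e' \<or> b \<in> e'" for e'
    using that e ab Suc.prems(1) unfolding one_factor_def by blast
  have "one_factor (V - e) (I - {e})"
    unfolding one_factor_def
  proof (intro conjI ballI)
    show "I - {e} \<subseteq> complete_edges (V - e)"
    proof
      fix e' assume e': "e' \<in> I - {e}"
      then have "e' \<in> complete_edges V" "a \<notin> e'" "b \<notin> e'"
        using Suc.prems(1) disj by (auto simp: one_factor_def)
      then show "e' \<in> complete_edges (V - e)" by (auto simp: complete_edges_def ab)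
    qed
    show "\<exists>!e'. e' \<in> I - {e} \<and> v \<in> e'" if v: "v \<in> V - e" for v
      using v Suc.prems(1) unfolding one_factor_def by blast
  qed
  moreover have "card (V - e) = 2 * m"
    using ab Suc.prems(2,3) by (simp add: card_Diff_subset)
  ultimately obtain f where f: "bij_betw f {..<2 * m} (V - e)"
    "(`) f ` standard_factor m = I - {e}"
    using Suc.IH[of "V - e" "I - {e}"] Suc.prems(2) by auto
  define g where "g = f(2 * m := a, 2 * m + 1 := b)"
  have gf: "g k = f k" if "k < 2 * m" for k using that by (simp add: g_def)
  have "bij_betw g ({..<2 * m} \<union> {2 * m, 2 * m + 1}) ((V - e) \<union> e)"
  proof (rule bij_betw_combine)
    show "bij_betw g {..<2 * m} (V - e)"
      using f(1) gf bij_betw_cong[of "{..<2 * m}" g f] by simp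
    show "bij_betw g {2 * m, 2 * m + 1} e"
      using ab by (auto simp: bij_betw_def g_def)
  qed auto
  moreover have "{..<2 * m} \<union> {2 * m, 2 * m + 1} = {..<2 * Suc m}" by auto
  moreover have "(V - e) \<union> e = V" using ab by auto
  moreover have "(`) g ` standard_factor m = (`) f ` standard_factor m"
    using gf by (auto simp: standard_factor_def intro!: image_cong)
  then have "(`) g ` standard_factor (Suc m) = I"
    using f(2) e ab by (auto simp: standard_factor_def lessThan_Suc g_def)
  ultimately show ?case by auto
qed

section \<open>Colourings\<close>

text \<open>The set of colours on a cycle is finite and nonempty, so it has more than one element
  unless it is a singleton.\<close>

lemma not_monochromatic_quad:
  "card (\<psi> ` \<Union> (quad a b c d)) > 1 \<longleftrightarrow> \<not> (\<psi> a = \<psi> b \<and> \<psi> b = \<psi> c \<and> \<psi> c = \<psi> d)"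
proof -
  have "card (\<psi> ` \<Union> (quad a b c d)) \<noteq> 0" by (simp add: Union_quad)
  then have "card (\<psi> ` \<Union> (quad a b c d)) > 1 \<longleftrightarrow> \<not> is_singleton (\<psi> ` \<Union> (quad a b c d))"
    unfolding is_singleton_altdef by linarith
  also have "\<dots> \<longleftrightarrow> \<not> (\<psi> a = \<psi> b \<and> \<psi> b = \<psi> c \<and> \<psi> c = \<psi> d)"
    by (auto simp: is_singleton_def Union_quad)
  finally show ?thesis .
qed

lemma colouring_image:
  "colouring k (f ` V) ((`) ((`) f) ` D) \<psi> \<longleftrightarrow> colouring k V D (\<psi> \<circ> f)"
proof -
  have "\<psi> ` \<Union> ((`) f ` C) = (\<psi> \<circ> f) ` \<Union> C" for C by auto
  then show ?thesis by (simp add: colouring_def image_comp)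
qed

lemma colouring_cong:
  assumes "\<And>v. v \<in> V \<Longrightarrow> \<phi> v = \<psi> v" "\<Union> (\<Union> D) \<subseteq> V"
  shows "colouring k V D \<phi> \<longleftrightarrow> colouring k V D \<psi>"
proof -
  have "\<phi> ` V = \<psi> ` V" using assms(1) by auto
  moreover have "\<phi> ` \<Union> C = \<psi> ` \<Union> C" if "C \<in> D" for C
    using assms that by (intro image_cong) auto
  ultimately show ?thesis by (simp add: colouring_def)
qed

text \<open>Unique 2-colourability with the colouring named and the two permutations of the colours
  spelled out: \<open>3 - c\<close> exchanges the colours 1 and 2.\<close>

definition forces :: "'a set \<Rightarrow> 'a set set set \<Rightarrow> ('a \<Rightarrow> nat) \<Rightarrow> bool" where
  "forces V D \<phi> \<longleftrightarrow> colouring 2 V D \<phi> \<and>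
     (\<forall>\<psi>. colouring 2 V D \<psi> \<longrightarrow> (\<forall>v\<in>V. \<psi> v = \<phi> v) \<or> (\<forall>v\<in>V. \<psi> v = 3 - \<phi> v))"

lemma forces_uniquely_colourable:
  assumes "forces V D \<phi>"
  shows "uniquely_colourable 2 V D"
  unfolding uniquely_colourable_def
proof (intro exI[of _ \<phi>] conjI allI impI)
  show "colouring 2 V D \<phi>" using assms by (simp add: forces_def)
  fix \<psi> assume "colouring 2 V D \<psi>"
  then consider "\<forall>v\<in>V. \<phi> v = \<psi> v" | "\<forall>v\<in>V. \<psi> v = 3 - \<phi> v"
    using assms by (auto simp: forces_def)
  then show "\<exists>\<sigma>. \<sigma> permutes {1..2} \<and> (\<forall>v\<in>V. \<phi> v = \<sigma> (\<psi> v))"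
  proof cases
    case 1
    then show ?thesis by (intro exI[of _ id]) (simp add: permutes_id)
  next
    case 2
    \<comment> \<open>On these two values \<open>3 - c\<close> agrees with the transposition of 1
      and 2.\<close>
    have "\<phi> ` V \<subseteq> {1, 2}" using assms by (auto simp: forces_def colouring_def)
    then have "\<forall>v\<in>V. \<phi> v = transpose 1 2 (\<psi> v)"
      using 2 by (auto simp: transpose_def)
    then show ?thesis
      by (intro exI[of _ "transpose 1 2"]) (simp add: permutes_swap_id)
  qed
qed

lemma uniquely_colourable_image:
  assumes "uniquely_colourable k V D" "inj_on f V" "\<Union> (\<Union> D) \<subseteq> V"
  shows "uniquely_colourable k (f ` V) ((`) ((`) f) ` D)"
proof -
  obtain \<phi> where \<phi>: "colouring k V D \<phi>"
    "\<And>\<psi>. colouring k V D \<psi> \<Longrightarrow> \<exists>\<sigma>. \<sigma> permutes {1..k} \<and> (\<forall>v\<in>V. \<phi> v = \<sigma> (\<psi> v))"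
    using assms(1) by (auto simp: uniquely_colourable_def)
  define \<phi>' where "\<phi>' = \<phi> \<circ> inv_into V f"
  have \<phi>': "\<phi>' (f v) = \<phi> v" if "v \<in> V" for v
    using that assms(2) by (simp add: \<phi>'_def)
  then have "colouring k V D (\<phi>' \<circ> f)"
    using \<phi>(1) colouring_cong[OF _ assms(3), of "\<phi>' \<circ> f" \<phi>] by simp
  moreover have "\<exists>\<sigma>. \<sigma> permutes {1..k} \<and> (\<forall>v\<in>f ` V. \<phi>' v = \<sigma> (\<psi> v))"
    if "colouring k V D (\<psi> \<circ> f)" for \<psi>
    using \<phi>(2)[OF that] \<phi>' by auto
  ultimately show ?thesis
    unfolding uniquely_colourable_def colouring_image by blast
qed

section \<open>Adding a pair of vertices\<close>

text \<open>
  The redundant cycle is \<open>quad x y z w\<close>: the remaining cycles \<open>D\<^sub>0\<close> already force the colouring \<open>\<phi>\<close>.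
  The vertices \<open>r, s\<close> and \<open>p, q\<close> are the further pairs of either colour that the extension needs.
\<close>

definition extensible :: "'a set \<Rightarrow> 'a set set \<Rightarrow> 'a set set set \<Rightarrow> bool" where
  "extensible V I D \<longleftrightarrow> (\<exists>D\<^sub>0 \<phi> x y z w r s p q.
     D = insert (quad x y z w) D\<^sub>0 \<and> quad x y z w \<notin> D\<^sub>0 \<and>
     four_cycle_decomposition (cocktail_party_edges V I) D \<and> forces V D\<^sub>0 \<phi> \<and>
     {x, y, z, w, r, s, p, q} \<subseteq> V \<and> distinct [x, y, z, w] \<and> distinct [x, z, r, s] \<and> p \<noteq> q \<and>
     \<phi> y = \<phi> x \<and> \<phi> z = \<phi> x \<and> \<phi> r = \<phi> x \<and> \<phi> s = \<phi> x \<and>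
     \<phi> w \<noteq> \<phi> x \<and> \<phi> p \<noteq> \<phi> x \<and> \<phi> q \<noteq> \<phi> x)"

text \<open>With two colours, avoiding one leaves exactly the other.\<close>

lemma colouring_2_not_eq_iff:
  assumes "colouring 2 V D \<psi>" "a \<in> V" "b \<in> V" "c \<in> V" "\<psi> a \<noteq> \<psi> b"
  shows "\<psi> c \<noteq> \<psi> b \<longleftrightarrow> \<psi> c = \<psi> a"
proof -
  have "\<psi> v = 1 \<or> \<psi> v = 2" if "v \<in> V" for v
    using assms(1) that by (auto simp: colouring_def)
  from this[OF assms(2)] this[OF assms(3)] this[OF assms(4)] show ?thesis
    using assms(5) by auto
qed

text \<open>Putting the redundant cycle back can only exclude colourings, and \<open>\<phi>\<close>
  survives because \<open>w\<close> and \<open>x\<close> differ in colour.\<close>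

lemma extensible_uniquely_colourable:
  assumes "extensible V I D"
  shows "four_cycle_decomposition (cocktail_party_edges V I) D \<and> uniquely_colourable 2 V D"
proof -
  obtain D\<^sub>0 \<phi> x y z w where D: "D = insert (quad x y z w) D\<^sub>0" "forces V D\<^sub>0 \<phi>" "\<phi> w \<noteq> \<phi> x"
    "four_cycle_decomposition (cocktail_party_edges V I) D"
    using assms by (auto simp: extensible_def)
  have "1 < card (\<phi> ` \<Union> (quad x y z w))"
    unfolding not_monochromatic_quad using D(3) by auto
  then have "forces V D \<phi>"
    using D(1,2) by (auto simp: forces_def colouring_def)
  then show ?thesis
    using D(4) forces_uniquely_colourable by blast
qed

text \<open>The edge \<open>{u, u'}\<close> joins the 1-factor, so the only new edges run between
  the new pair and the old vertices.\<close>

lemma cocktail_party_edges_insert_pair: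
  assumes "I \<subseteq> complete_edges V" "u \<notin> V" "u' \<notin> V" "u \<noteq> u'"
  shows "cocktail_party_edges (insert u (insert u' V)) (insert {u, u'} I) =
    cocktail_party_edges V I \<union> spokes u u' V" (is "?L = ?R")
proof (rule set_eqI)
  fix e :: "'a set"
  consider a b where "e = {a, b}" "a \<noteq> b" | "card e \<noteq> 2"
    by (metis card_2_iff)
  then show "e \<in> ?L \<longleftrightarrow> e \<in> ?R"
  proof cases
    case 1
    have "e \<notin> I" if "\<not> e \<subseteq> V"
      using that assms(1) by (auto simp: complete_edges_def)
    then show ?thesis
      using 1 assms(2-4)
      by (auto simp: cocktail_party_edges_def complete_edges_def spokes_def doubleton_eq_iff)
  next
    case 2
    moreover have "card f = 2" if "f \<in> spokes u u' V" for f
      using that assms(2,3) by (auto simp: spokes_def card_2_iff)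
    ultimately show ?thesis
      by (auto simp: cocktail_party_edges_def complete_edges_def)
  qed
qed

lemma extensible_insert_pair:
  assumes V: "finite V" "even (card V)" and I: "I \<subseteq> complete_edges V"
    and u: "u \<notin> V" "u' \<notin> V" "u \<noteq> u'" and D: "extensible V I D"
  shows "\<exists>D'. extensible (insert u (insert u' V)) (insert {u, u'} I) D'"
proof -
  let ?V = "insert u (insert u' V)" and ?I = "insert {u, u'} I"
  let ?E = "cocktail_party_edges V I"
  obtain D\<^sub>0 \<phi> x y z w r s p q where
    Q: "D = insert (quad x y z w) D\<^sub>0" "quad x y z w \<notin> D\<^sub>0"
    and dec: "four_cycle_decomposition ?E D" and forces: "forces V D\<^sub>0 \<phi>"
    and mem: "{x, y, z, w, r, s, p, q} \<subseteq> V"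
    and dist: "distinct [x, y, z, w]" "distinct [x, z, r, s]" "p \<noteq> q"
    and \<phi>: "\<phi> y = \<phi> x" "\<phi> z = \<phi> x" "\<phi> r = \<phi> x" "\<phi> s = \<phi> x"
      "\<phi> w \<noteq> \<phi> x" "\<phi> p \<noteq> \<phi> x" "\<phi> q \<noteq> \<phi> x"
    using D unfolding extensible_def by (elim exE conjE) (rule that)
  \<comment> \<open>The colours separate \<open>p\<close> and \<open>q\<close> from the other four
    vertices.\<close>
  have dist': "distinct [x, z, r, s, p, q]"
    using dist(2,3) \<phi> by auto
  define W where "W = V - {x, z, r, s, p, q}"
  have "card W = card V - 6"
    using mem dist' V(1) by (simp add: W_def card_Diff_subset)
  then have "even (card W)" using V(2) by simp
  then obtain M\<^sub>0 where M\<^sub>0: "partition_on W M\<^sub>0" "\<forall>e\<in>M\<^sub>0. card e = 2"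
    using ex_partition_into_pairs V(1) by (metis W_def finite_Diff)
  \<comment> \<open>The pairs \<open>{x, z}\<close> and \<open>{r, s}\<close> of the perfect
    matching are left out: the spokes of the first go into the trade, those of the second form
    \<open>Q'\<close>.\<close>
  define M where "M = insert {p, q} M\<^sub>0"
  have pq: "disjnt {p, q} (\<Union> M\<^sub>0)"
    using partition_onD1[OF M\<^sub>0(1)] by (auto simp: W_def disjnt_iff)
  have M: "partition_on (V - {x, z, r, s}) M"
  proof -
    have "V - {x, z, r, s} - {p, q} = W" by (auto simp: W_def)
    then show ?thesis
      using M\<^sub>0(1) mem dist' by (auto simp: M_def partition_on_insert[OF pq])
  qed
  define A where "A = quad u x y z"
  define B where "B = quad u' x w z"
  define Q' where "Q' = quad r u' s u"
  define D\<^sub>1 where "D\<^sub>1 = D\<^sub>0 \<union> ({A, B} \<union> spokes u u' ` M)"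
  \<comment> \<open>\<open>spokes_pair\<close> yields the same cycle traversed in the opposite
    direction. Reversing each doubleton leaves only a different order of the four edges.\<close>
  have Q': "Q' = spokes u u' {r, s}"
    unfolding Q'_def spokes_pair quad_def
      insert_commute[of r u' "{}"] insert_commute[of u' s "{}"] insert_commute[of s u "{}"]
      insert_commute[of u r "{}"]
    by (rule set_eqI) (simp only: insert_iff empty_iff simp_thms disj_ac)
  have E: "partition_on ?E (insert (quad x y z w) D\<^sub>0)" "\<And>C. C \<in> D\<^sub>0 \<Longrightarrow> four_cycle C"
    using dec by (auto simp: four_cycle_decomposition_iff Q(1))
  have "disjnt (quad x y z w) (\<Union> D\<^sub>0)"
    using partition_onD2[OF E(1)] Q(2) by (fastforce simp: disjoint_def disjnt_def)
  then have D\<^sub>0: "partition_on (?E - quad x y z w) D\<^sub>0" and QE: "quad x y z w \<subseteq> ?E"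
    using E(1) by (simp_all add: partition_on_insert)
  have Union_E: "\<Union> ?E \<subseteq> V"
    by (auto simp: cocktail_party_edges_def complete_edges_def)
  have sub: "\<Union> (\<Union> D\<^sub>0) \<subseteq> V"
    using partition_onD1[OF D\<^sub>0] Union_E by blast
  have uE: "e \<notin> ?E" if "u \<in> e \<or> u' \<in> e" for e
    using that Union_E u by blast
  have ne: "v \<noteq> u" "v \<noteq> u'" if "v \<in> V" for v
    using that u by auto
  \<comment> \<open>The old cycle splits into the paths x-y-z and x-w-z. \<open>A\<close> closes the
    first through \<open>u\<close>, and \<open>B\<close> closes the second through
    \<open>u'\<close>.\<close>
  have AB: "partition_on (quad x y z w \<union> spokes u u' {x, z}) {A, B}"
  proof (rule partition_onI)
    show "\<Union> {A, B} = quad x y z w \<union> spokes u u' {x, z}"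
      unfolding A_def B_def spokes_pair quad_def insert_commute[of z w "{}"]
        insert_commute[of w x "{}"] insert_commute[of x u "{}"] insert_commute[of u z "{}"]
      by (rule set_eqI) (simp only: Union_insert Union_empty Un_iff insert_iff empty_iff simp_thms disj_ac)
    have neq: "x \<noteq> u" "x \<noteq> u'" "y \<noteq> u" "y \<noteq> u'" "z \<noteq> u" "z \<noteq> u'" "w \<noteq> u" "w \<noteq> u'"
      using mem ne by auto
    have "disjnt A B"
      unfolding A_def B_def quad_def disjnt_insert1 disjnt_insert2
      using dist(1) u(3) neq neq[symmetric]
      by (simp add: doubleton_eq_iff) (metis disjnt_empty1)?
    then show "disjnt a b" if "a \<in> {A, B}" "b \<in> {A, B}" "a \<noteq> b" for a b
      using that by (auto simp: disjnt_sym)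
  qed (auto simp: A_def B_def quad_def)
  have S: "partition_on (spokes u u' (V - {x, z, r, s})) (spokes u u' ` M)"
    by (rule partition_on_spokes[OF M]) (use u in auto)
  have D\<^sub>1: "partition_on ((?E - quad x y z w) \<union> ((quad x y z w \<union> spokes u u' {x, z}) \<union>
      spokes u u' (V - {x, z, r, s}))) D\<^sub>1"
    unfolding D\<^sub>1_def
  proof (intro partition_on_Un D\<^sub>0 AB S)
    have sE: "disjnt ?E (spokes u u' X)" for X
      using uE by (auto simp: disjnt_iff spokes_def)
    show "disjnt (quad x y z w \<union> spokes u u' {x, z}) (spokes u u' (V - {x, z, r, s}))"
      using QE sE[of "V - {x, z, r, s}"] disjnt_spokes[of "{x, z}" "V - {x, z, r, s}" u u'] mem u
      by (auto simp: disjnt_iff)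
    show "disjnt (?E - quad x y z w)
        (quad x y z w \<union> spokes u u' {x, z} \<union> spokes u u' (V - {x, z, r, s}))"
      using sE[of "V - {x, z, r, s}"] sE[of "{x, z}"] by (auto simp: disjnt_iff)
  qed
  \<comment> \<open>Apart from the spokes of \<open>{r, s}\<close>, the new graph consists of the
    old edges outside the redundant cycle, the edges of the trade, and the spokes of the matched
    rest.\<close>
  have E': "cocktail_party_edges ?V ?I - Q' = (?E - quad x y z w) \<union>
      ((quad x y z w \<union> spokes u u' {x, z}) \<union> spokes u u' (V - {x, z, r, s}))"
    and Q'E: "Q' \<subseteq> cocktail_party_edges ?V ?I"
  proof -
    define X where "X = {x, z} \<union> (V - {x, z, r, s})"
    have X: "spokes u u' X = spokes u u' {x, z} \<union> spokes u u' (V - {x, z, r, s})"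
      unfolding X_def by (rule spokes_Un)
    have "disjnt Q' ?E" using uE by (auto simp: Q' disjnt_iff spokes_def)
    moreover have "disjnt Q' (spokes u u' X)"
      unfolding Q' by (rule disjnt_spokes) (use mem u dist(2) in \<open>auto simp: X_def disjnt_iff\<close>)
    moreover have "V = {r, s} \<union> X" using mem by (auto simp: X_def)
    then have "spokes u u' V = Q' \<union> spokes u u' X" by (metis Q' spokes_Un)
    then have "cocktail_party_edges ?V ?I = ?E \<union> (Q' \<union> spokes u u' X)"
      by (simp add: cocktail_party_edges_insert_pair[OF I u])
    ultimately show "cocktail_party_edges ?V ?I - Q' = (?E - quad x y z w) \<union>
        ((quad x y z w \<union> spokes u u' {x, z}) \<union> spokes u u' (V - {x, z, r, s}))"
      and "Q' \<subseteq> cocktail_party_edges ?V ?I"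
      using QE by (auto simp: X disjnt_iff)
  qed
  have D\<^sub>1': "partition_on (cocktail_party_edges ?V ?I - Q') D\<^sub>1"
    using D\<^sub>1 E' by simp
  have "disjnt Q' (\<Union> D\<^sub>1)"
    using partition_onD1[OF D\<^sub>1'] by (auto simp: disjnt_iff)
  moreover have "Q' \<noteq> {}" by (simp add: Q'_def quad_def)
  ultimately have part: "partition_on (cocktail_party_edges ?V ?I) (insert Q' D\<^sub>1)" "Q' \<notin> D\<^sub>1"
    using D\<^sub>1' Q'E by (auto simp: partition_on_insert disjnt_iff)
  have pair: "\<exists>a b. a \<in> V \<and> b \<in> V \<and> a \<noteq> b \<and> e = {a, b}" if "e \<in> M" for e
  proof -
    have "card e = 2" "e \<subseteq> V"
      using that M\<^sub>0(2) dist(3) partition_onD1[OF M] by (auto simp: M_def)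
    then show ?thesis by (auto simp: card_2_iff)
  qed
  have "four_cycle C" if "C \<in> insert Q' D\<^sub>1" for C
  proof -
    have "four_cycle Q'" "four_cycle A" "four_cycle B"
      unfolding Q'_def A_def B_def using dist(1,2) u mem ne
      by (auto intro!: four_cycle_quad)
    moreover have "four_cycle (spokes u u' e)" if "e \<in> M" for e
      using pair[OF that] u by (auto simp: spokes_pair intro!: four_cycle_quad)
    ultimately show ?thesis using that E(2) by (auto simp: D\<^sub>1_def)
  qed
  with part(1) have dec': "four_cycle_decomposition (cocktail_party_edges ?V ?I) (insert Q' D\<^sub>1)"
    by (simp add: four_cycle_decomposition_iff)
  define \<phi>' where "\<phi>' = \<phi>(u := \<phi> w, u' := \<phi> x)"
  have \<phi>'[simp]: "\<phi>' u = \<phi> w" "\<phi>' u' = \<phi> x" "\<And>v. v \<in> V \<Longrightarrow> \<phi>' v = \<phi> v"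
    using u by (auto simp: \<phi>'_def)
  have col: "colouring 2 V D\<^sub>0 \<phi>"
    using forces by (simp add: forces_def)
  have wx: "\<phi> v \<noteq> \<phi> x \<longleftrightarrow> \<phi> v = \<phi> w" if "v \<in> V" for v
    using colouring_2_not_eq_iff[OF col] mem \<phi>(5) that by auto
  have V': "x \<in> V" "y \<in> V" "z \<in> V" "w \<in> V" "r \<in> V" "s \<in> V" "p \<in> V" "q \<in> V"
    using mem by auto
  have forces': "forces ?V D\<^sub>1 \<phi>'"
    unfolding forces_def
  proof (intro conjI allI impI)
    have "colouring 2 V D\<^sub>0 \<phi>'"
      using col colouring_cong[OF _ sub, of \<phi>' \<phi>] by simp
    \<comment> \<open>\<open>A\<close> contains \<open>u\<close> and \<open>x\<close>,
      \<open>B\<close> contains \<open>w\<close> and \<open>x\<close>, and below every spoke cycle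
      contains both \<open>u\<close> and \<open>u'\<close>; each time the two colours
      differ.\<close>
    moreover have "1 < card (\<phi>' ` \<Union> A)" "1 < card (\<phi>' ` \<Union> B)"
      unfolding A_def B_def not_monochromatic_quad using \<phi>(5) V' by auto
    moreover have "1 < card (\<phi>' ` \<Union> (spokes u u' e))" if e: "e \<in> M" for e
    proof -
      obtain a b where "e = {a, b}" using pair[OF e] by blast
      then show ?thesis
        unfolding \<open>e = {a, b}\<close> spokes_pair not_monochromatic_quad using \<phi>(5) by auto
    qed
    ultimately show "colouring 2 ?V D\<^sub>1 \<phi>'"
      using V' col by (auto simp: colouring_def D\<^sub>1_def)
  next
    fix \<psi> assume \<psi>: "colouring 2 ?V D\<^sub>1 \<psi>"
    then have "colouring 2 V D\<^sub>0 \<psi>"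
      by (auto simp: colouring_def D\<^sub>1_def)
    \<comment> \<open>On the old vertices \<open>\<psi>\<close> is \<open>\<phi>\<close> or its
      swap, so only the colours of \<open>u\<close> and \<open>u'\<close> remain to be
      determined.\<close>
    then have *: "(\<forall>v\<in>V. \<psi> v = \<phi> v) \<or> (\<forall>v\<in>V. \<psi> v = 3 - \<phi> v)"
      using forces by (simp add: forces_def)
    have rng: "\<phi> v = 1 \<or> \<phi> v = 2" if "v \<in> V" for v
      using col that by (auto simp: colouring_def)
    have rng': "\<psi> v = 1 \<or> \<psi> v = 2" if "v \<in> ?V" for v
      using \<psi> that by (auto simp: colouring_def)
    have "1 < card (\<psi> ` \<Union> A)" "1 < card (\<psi> ` \<Union> (spokes u u' {p, q}))"
      using \<psi> by (auto simp: colouring_def D\<^sub>1_def M_def)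
    then have A: "\<not> (\<psi> u = \<psi> x \<and> \<psi> x = \<psi> y \<and> \<psi> y = \<psi> z)"
      and P: "\<not> (\<psi> p = \<psi> u \<and> \<psi> u = \<psi> q \<and> \<psi> q = \<psi> u')"
      unfolding A_def spokes_pair not_monochromatic_quad by blast+
    have "\<phi> p = \<phi> w" "\<phi> q = \<phi> w" using wx V' \<phi> by blast+
    then have same: "\<psi> y = \<psi> x" "\<psi> z = \<psi> x" "\<psi> p = \<psi> w" "\<psi> q = \<psi> w"
      using * V' \<phi>(1,2) by auto
    \<comment> \<open>The swap keeps different colours different because \<open>3 - c\<close> is
      injective on 1 and 2.\<close>
    have "\<psi> w \<noteq> \<psi> x"
      using * V' \<phi>(5) rng[of x] rng[of w] by auto
    moreover have "\<psi> u \<noteq> \<psi> x" using A same by simp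
    ultimately have "\<psi> u = \<psi> w" using rng'[of u] rng'[of x] rng'[of w] V' by auto
    moreover from this have "\<psi> u' \<noteq> \<psi> w" using P same by simp
    then have "\<psi> u' = \<psi> x"
      using \<open>\<psi> w \<noteq> \<psi> x\<close> rng'[of u'] rng'[of x] rng'[of w] V' by auto
    ultimately show "(\<forall>v\<in>?V. \<psi> v = \<phi>' v) \<or> (\<forall>v\<in>?V. \<psi> v = 3 - \<phi>' v)"
      using * V' by auto
  qed
  \<comment> \<open>The new redundant cycle takes \<open>r\<close>, \<open>u'\<close>,
    \<open>s\<close>, \<open>u\<close> for the old \<open>x\<close>, \<open>y\<close>,
    \<open>z\<close>, \<open>w\<close>. The old \<open>x\<close>, \<open>z\<close> become the
    further pair of the same colour, and \<open>p\<close>, \<open>q\<close> are kept.\<close>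
  have "extensible ?V ?I (insert Q' D\<^sub>1)"
    unfolding extensible_def
    by (rule exI[of _ D\<^sub>1], rule exI[of _ \<phi>'], rule exI[of _ r], rule exI[of _ u'],
      rule exI[of _ s], rule exI[of _ u], rule exI[of _ x], rule exI[of _ z],
      rule exI[of _ p], rule exI[of _ q],
      use forces' dec' part(2) V' dist \<phi> ne u in \<open>auto simp: Q'_def\<close>)
  then show ?thesis by blast
qed

section \<open>A decomposition on 22 vertices\<close>

text \<open>
  Together with the redundant cycle \<open>quad 14 17 15 3\<close> these cycles decompose the cocktail party graph
  whose removed 1-factor is \<open>{0, 1}, {2, 3}, \<dots>, {20, 21}\<close>.
\<close>

definition base_quads :: "(nat \<times> nat \<times> nat \<times> nat) list" where
  "base_quads =
   [(0,2,1,9), (0,3,1,14), (0,4,9,12), (0,5,10,16), (0,6,4,13), (0,7,18,15),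
    (0,8,15,20), (0,10,1,19), (0,11,20,18), (0,17,19,21), (1,4,11,5), (1,6,16,21),
    (1,7,5,17), (1,8,13,15), (1,11,13,16), (1,12,18,13), (1,18,10,20), (2,4,21,10),
    (2,5,20,7), (2,6,3,17), (2,8,19,14), (2,9,6,20), (2,11,15,16), (2,12,7,21),
    (2,13,17,18), (2,15,5,19), (3,4,14,16), (3,5,16,19), (3,7,15,10), (3,8,21,9),
    (3,11,19,13), (3,12,14,20), (3,18,11,21), (4,7,11,8), (4,10,8,20), (4,12,19,15),
    (4,16,20,17), (4,18,9,19), (5,6,15,21), (5,8,7,13), (5,9,13,14), (5,12,8,18),
    (6,8,16,11), (6,10,7,17), (6,12,16,18), (6,13,10,19), (6,14,18,21), (7,9,20,19),
    (7,14,9,16), (8,14,21,17), (9,10,12,11), (9,15,12,17), (10,14,11,17), (12,20,13,21)]"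

text \<open>Each edge is written as an increasing pair, so that disjointness of cycles becomes
  distinctness of a list, which can be computed.\<close>

definition quad_edges :: "nat \<times> nat \<times> nat \<times> nat \<Rightarrow> (nat \<times> nat) list" where
  "quad_edges = (\<lambda>(a, b, c, d). map (\<lambda>(i, j). (min i j, max i j)) [(a, b), (b, c), (c, d), (d, a)])"

definition base_colouring :: "nat \<Rightarrow> nat" where
  "base_colouring v = (if v \<in> {0, 1, 2, 3, 4, 5, 6, 7, 8, 10, 12} then 1 else 2)"

section \<open>Checking that the base cycles partition the edges\<close>

lemma set_quad_edges: "(\<lambda>(i, j). {i, j}) ` set (quad_edges (a, b, c, d)) = quad a b c d"
  by (auto simp: quad_edges_def quad_def min_def max_def insert_commute)

lemma image_quad_edges:
  "(\<lambda>(i, j). {i, j}) ` set (concat (map quad_edges qs)) = \<Union> ((\<lambda>(a, b, c, d). quad a b c d) ` set qs)"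
  by (induction qs) (auto simp: image_Un set_quad_edges split: prod.splits)

text \<open>On increasing pairs the passage from \<open>(i, j)\<close> to \<open>{i, j}\<close> is
  injective. Hence a list of pairs without repetition gives pairwise disjoint cycles, and the first
  cycle, being nonempty, cannot occur again.\<close>

lemma partition_on_quads:
  assumes "distinct (concat (map quad_edges ((a, b, c, d) # qs)))"
    and "\<forall>(i, j)\<in>set (concat (map quad_edges ((a, b, c, d) # qs))). i < j"
  shows "quad a b c d \<notin> (\<lambda>(a, b, c, d). quad a b c d) ` set qs"
    and "partition_on ((\<lambda>(i, j). {i, j}) ` set (concat (map quad_edges ((a, b, c, d) # qs))))
      (insert (quad a b c d) ((\<lambda>(a, b, c, d). quad a b c d) ` set qs))"
proof -
  let ?e = "\<lambda>(i, j). {i, j}" and ?q = "\<lambda>(a, b, c, d). quad a b c d"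
  let ?E = "\<lambda>qs. ?e ` set (concat (map quad_edges qs))"
  have disj: "disjnt (quad a b c d) (?E qs)"
    if d: "distinct (concat (map quad_edges ((a, b, c, d) # qs)))"
      "\<forall>(i, j)\<in>set (concat (map quad_edges ((a, b, c, d) # qs))). i < j" for a b c d qs
  proof -
    let ?S = "set (concat (map quad_edges ((a, b, c, d) # qs)))"
    have "inj_on ?e {(i :: nat, j). i < j}"
      by (auto simp: inj_on_def doubleton_eq_iff)
    then have "inj_on ?e ?S" by (rule inj_on_subset) (use d(2) in blast)
    let ?A = "set (quad_edges (a, b, c, d))" and ?B = "set (concat (map quad_edges qs))"
    have "?A \<subseteq> ?S" "?B \<subseteq> ?S" "?A \<inter> ?B = {}"
      using d(1) by auto
    with inj_on_image_Int[OF \<open>inj_on ?e ?S\<close>, of ?A ?B] have "?e ` ?A \<inter> ?E qs = {}"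
      by simp
    then show ?thesis by (simp only: set_quad_edges disjnt_def)
  qed
  have part: "partition_on (?E qs) (?q ` set qs)"
    if "distinct (concat (map quad_edges qs))"
      "\<forall>(i, j)\<in>set (concat (map quad_edges qs)). i < j" for qs
    using that
  proof (induction qs)
    case Nil
    then show ?case by (simp add: partition_on_def)
  next
    case (Cons q qs)
    obtain a b c d where q: "q = (a, b, c, d)" by (metis prod_cases4)
    have "disjnt (quad a b c d) (?E qs)"
      using Cons.prems unfolding q by (rule disj)
    moreover have "partition_on (?E qs) (?q ` set qs)"
      using Cons by (auto intro!: Cons.IH)
    moreover have "quad a b c d \<noteq> {}" by (simp add: quad_def)
    ultimately have "partition_on (quad a b c d \<union> ?E qs) ({quad a b c d} \<union> ?q ` set qs)"
      by (intro partition_on_Un partition_on_space)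
    moreover have "?E (q # qs) = quad a b c d \<union> ?E qs"
      by (simp only: q list.map concat.simps set_append image_Un set_quad_edges)
    ultimately show ?case by (simp add: q)
  qed
  show "quad a b c d \<notin> ?q ` set qs"
  proof
    assume "quad a b c d \<in> ?q ` set qs"
    then have "quad a b c d \<subseteq> ?E qs" unfolding image_quad_edges by (rule Union_upper)
    moreover have "quad a b c d \<noteq> {}" by (simp add: quad_def)
    ultimately show False using disj[OF assms] by (auto simp: disjnt_iff)
  qed
  show "partition_on (?E ((a, b, c, d) # qs)) (insert (quad a b c d) (?q ` set qs))"
    using part[OF assms] by simp
qed

lemma base_distinct: "distinct (concat (map quad_edges ((14,17,15,3) # base_quads)))"
  by (simp add: base_quads_def quad_edges_def)

text \<open>Only one inclusion is checked pair by pair. Equality follows by counting: 55 cycles give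
  220 distinct pairs, and there are 22 * 20 / 2 = 220 edges.\<close>

lemma base_edges:
  "set (concat (map quad_edges ((14,17,15,3) # base_quads))) =
    {(i, j). i < j \<and> j < 22 \<and> i div 2 \<noteq> j div 2}" (is "set ?es = ?F")
proof (rule card_subset_eq)
  have F: "?F = set (filter (\<lambda>(i, j). i < j \<and> i div 2 \<noteq> j div 2) (List.product [0..<22] [0..<22]))"
    by auto
  then show "finite ?F" by (metis List.finite_set)
  have "\<forall>(i, j)\<in>set ?es. i < j \<and> j < 22 \<and> i div 2 \<noteq> j div 2"
    by (simp add: base_quads_def quad_edges_def)
  then show "set ?es \<subseteq> ?F" by blast
  have "card (set ?es) = length ?es"
    by (rule distinct_card[OF base_distinct])
  also have "\<dots> = 220"
    by (simp add: base_quads_def quad_edges_def)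
  also have "\<dots> = length (filter (\<lambda>(i, j). i < j \<and> i div 2 \<noteq> j div 2)
      (List.product [0..<22] [0..<22 :: nat]))"
    by code_simp
  also have "\<dots> = card ?F"
    unfolding F by (rule distinct_card[symmetric]) (simp add: distinct_product)
  finally show "card (set ?es) = card ?F" .
qed

text \<open>Two different numbers are matched by \<open>standard_factor\<close> exactly when they
  have the same half, rounded down.\<close>

lemma cocktail_party_edges_standard:
  "cocktail_party_edges {..<2 * m} (standard_factor m) =
    (\<lambda>(i, j). {i, j}) ` {(i, j). i < j \<and> j < 2 * m \<and> i div 2 \<noteq> j div 2}" (is "?L = ?R")
proof -
  have *: "{i, j} \<in> ?L \<longleftrightarrow> i div 2 \<noteq> j div 2" if ij: "i < j" "j < 2 * m" for i j
  proof -
    have "{i, j} \<in> standard_factor m \<longleftrightarrow> i div 2 = j div 2"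
    proof
      assume "i div 2 = j div 2"
      then obtain k where "i = 2 * k" "j = 2 * k + 1" "k < m"
        using ij by (intro that[of "i div 2"]) presburger+
      then show "{i, j} \<in> standard_factor m"
        by (auto simp: standard_factor_def)
    qed (auto simp: standard_factor_def doubleton_eq_iff)
    then show ?thesis using that by (auto simp: cocktail_party_edges_def complete_edges_def)
  qed
  have "\<exists>i j. e = {i, j} \<and> i < j \<and> j < 2 * m" if "e \<in> ?L" for e
  proof -
    have "e \<subseteq> {..<2 * m}" "card e = 2"
      using that by (auto simp: cocktail_party_edges_def complete_edges_def)
    then obtain a b where "e = {a, b}" "a \<noteq> b" "a < 2 * m" "b < 2 * m"
      unfolding card_2_iff by blast
    then show ?thesis
      using insert_commute[of a b "{}"] by (metis linorder_neqE_nat)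
  qed
  note pair = this
  show ?thesis
  proof (intro equalityI subsetI)
    fix e assume e: "e \<in> ?L"
    then obtain i j where ij: "e = {i, j}" "i < j" "j < 2 * m"
      using pair by blast
    then have "(i, j) \<in> {(i, j). i < j \<and> j < 2 * m \<and> i div 2 \<noteq> j div 2}"
      using e * by simp
    then show "e \<in> ?R" by (rule rev_image_eqI) (simp add: ij(1))
  next
    fix e assume "e \<in> ?R"
    then show "e \<in> ?L" using * by auto
  qed
qed

text \<open>Let \<open>P v\<close> say that \<open>v\<close> has colour 1. Each cycle then gives two
  clauses, not all true and not all false. Over 22 propositional variables these clauses leave only
  the given pattern and its negation, which \<open>sat\<close> proves.\<close>

lemma base_forces:
  assumes "colouring 2 {..<22} ((\<lambda>(a, b, c, d). quad a b c d) ` set base_quads) \<psi>"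
  shows "(\<forall>v\<in>{..<22}. \<psi> v = base_colouring v) \<or> (\<forall>v\<in>{..<22}. \<psi> v = 3 - base_colouring v)"
proof -
  define P where "P v \<longleftrightarrow> \<psi> v = 1" for v
  have \<psi>: "\<psi> v = (if P v then 1 else 2)" if "v < 22" for v
    using assms that by (auto simp: colouring_def P_def)
  have *: "\<not> (P a \<and> P b \<and> P c \<and> P d) \<and> (P a \<or> P b \<or> P c \<or> P d)"
    if "(a, b, c, d) \<in> set base_quads" "a < 22" "b < 22" "c < 22" "d < 22" for a b c d
  proof -
    have "1 < card (\<psi> ` \<Union> (quad a b c d))"
      using assms that(1) by (auto simp: colouring_def)
    then show ?thesis
      unfolding not_monochromatic_quad that(2-)[THEN \<psi>] by (simp split: if_splits)
  qed
  have "\<forall>(a, b, c, d)\<in>set base_quads.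
      \<not> (P a \<and> P b \<and> P c \<and> P d) \<and> (P a \<or> P b \<or> P c \<or> P d)"
  proof -
    have "\<forall>(a, b, c, d)\<in>set base_quads. a < 22 \<and> b < 22 \<and> c < 22 \<and> d < 22"
      by (simp add: base_quads_def)
    then show ?thesis using * by blast
  qed
  then have "(P 0 \<and> P 1 \<and> P 2 \<and> P 3 \<and> P 4 \<and> P 5 \<and> P 6 \<and> P 7 \<and> P 8 \<and> \<not> P 9 \<and> P 10 \<and>
      \<not> P 11 \<and> P 12 \<and> \<not> P 13 \<and> \<not> P 14 \<and> \<not> P 15 \<and> \<not> P 16 \<and> \<not> P 17 \<and> \<not> P 18 \<and> \<not> P 19 \<and>
      \<not> P 20 \<and> \<not> P 21) \<or>
    (\<not> P 0 \<and> \<not> P 1 \<and> \<not> P 2 \<and> \<not> P 3 \<and> \<not> P 4 \<and> \<not> P 5 \<and> \<not> P 6 \<and> \<not> P 7 \<and> \<not> P 8 \<and> P 9 \<and> \<not> P 10 \<and>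
      P 11 \<and> \<not> P 12 \<and> P 13 \<and> P 14 \<and> P 15 \<and> P 16 \<and> P 17 \<and> P 18 \<and> P 19 \<and>
      P 20 \<and> P 21)"
    unfolding base_quads_def list.set ball_simps prod.case by sat
  moreover have "{..<22::nat} = {0, 1, 2, 3, 4, 5, 6, 7, 8, 9, 10, 11, 12, 13, 14, 15, 16, 17, 18,
      19, 20, 21}"
    by (simp add: lessThan_nat_numeral lessThan_Suc insert_commute)
  ultimately show ?thesis
    using \<psi> by (elim disjE conjE) (simp_all add: base_colouring_def)
qed

lemma ex_extensible_22: "\<exists>D. extensible {..<22} (standard_factor 11) D"
proof -
  let ?Q = "quad 14 17 15 (3::nat)" and ?D = "(\<lambda>(a, b, c, d). quad a b c d) ` set base_quads"
  have "\<forall>(i, j)\<in>set (concat (map quad_edges ((14,17,15,3) # base_quads))). i < j"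
    unfolding base_edges by blast
  note part = partition_on_quads[OF base_distinct this]
  have "partition_on (cocktail_party_edges {..<22} (standard_factor 11)) (insert ?Q ?D)"
    using part(2) cocktail_party_edges_standard[of 11] by (simp only: base_edges) simp
  moreover have "\<forall>(a, b, c, d)\<in>set base_quads. distinct [a, b, c, d]"
    by (simp add: base_quads_def)
  then have "\<forall>C\<in>?D. four_cycle C" by (auto intro!: four_cycle_quad)
  moreover have "four_cycle ?Q" by (rule four_cycle_quad) simp
  ultimately have dec: "four_cycle_decomposition (cocktail_party_edges {..<22} (standard_factor 11))
      (insert ?Q ?D)"
    by (simp add: four_cycle_decomposition_iff)
  have *: "\<forall>(a, b, c, d)\<in>set base_quads. \<not> (base_colouring a = base_colouring b \<and>
      base_colouring b = base_colouring c \<and> base_colouring c = base_colouring d)"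
    by (simp add: base_quads_def base_colouring_def)
  have "1 < card (base_colouring ` \<Union> C)" if C: "C \<in> ?D" for C
  proof -
    obtain a b c d where C: "(a, b, c, d) \<in> set base_quads" "C = quad a b c d"
      using C by auto
    show ?thesis
      unfolding C(2) not_monochromatic_quad using * C(1) by blast
  qed
  then have "colouring 2 {..<22} ?D base_colouring"
    by (auto simp: colouring_def base_colouring_def)
  then have forces: "forces {..<22} ?D base_colouring"
    using base_forces by (simp add: forces_def)
  have "extensible {..<22} (standard_factor 11) (insert ?Q ?D)"
    unfolding extensible_def
    \<comment> \<open>The majority colour of the redundant cycle is 2 here: it is shared by 14, 17,
      15 and the pair 16, 18, while 3 and the pair 0, 1 have colour 1.\<close>
    by (rule exI[of _ ?D], rule exI[of _ base_colouring], rule exI[of _ 14], rule exI[of _ 17],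
      rule exI[of _ 15], rule exI[of _ 3], rule exI[of _ 16], rule exI[of _ 18],
      rule exI[of _ 0], rule exI[of _ 1],
      use forces dec part(1) in \<open>simp add: base_colouring_def\<close>)
  then show ?thesis by blast
qed

section \<open>Induction on the number of pairs, and transfer to an arbitrary 1-factor\<close>

lemma ex_extensible:
  assumes "11 \<le> m"
  shows "\<exists>D. extensible {..<2 * m} (standard_factor m) D"
  using assms
proof (induction m rule: dec_induct)
  case base
  then show ?case using ex_extensible_22 by simp
next
  case (step m)
  then obtain D where D: "extensible {..<2 * m} (standard_factor m) D" by blast
  have "{..<2 * Suc m} = insert (2 * m) (insert (2 * m + 1) {..<2 * m})" by auto
  moreover have "standard_factor (Suc m) = insert {2 * m, 2 * m + 1} (standard_factor m)"
    by (simp add: standard_factor_def lessThan_Suc)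
  ultimately show ?case
    using extensible_insert_pair[OF _ _ standard_factor_subset _ _ _ D, of "2 * m" "2 * m + 1"]
    by simp
qed

text \<open>A bijection that carries the standard 1-factor to \<open>I\<close> transports the
  decomposition on numbers, together with its unique colouring, to \<open>V\<close>.\<close>

theorem theorem1p3:
  fixes n :: nat and V :: "'a set" and I :: "'a set set"
  assumes "even n" and "n \<ge> 50"
    and "finite V" and "card V = n"
    and "one_factor V I"
  shows "\<exists>D. four_cycle_decomposition (cocktail_party_edges V I) D \<and>
             uniquely_colourable 2 V D"
proof -
  obtain m where m: "n = 2 * m" using \<open>even n\<close> by blast
  then obtain f where f: "bij_betw f {..<2 * m} V" "(`) f ` standard_factor m = I"
    using one_factor_standard assms(3-5) by blast
  then have inj: "inj_on f {..<2 * m}" and V: "f ` {..<2 * m} = V"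
    by (auto simp: bij_betw_def)
  obtain D where "extensible {..<2 * m} (standard_factor m) D"
    using ex_extensible[of m] m \<open>n \<ge> 50\<close> by auto
  then have D: "four_cycle_decomposition (cocktail_party_edges {..<2 * m} (standard_factor m)) D"
    "uniquely_colourable 2 {..<2 * m} D"
    using extensible_uniquely_colourable by blast+
  have "\<Union> (\<Union> D) \<subseteq> {..<2 * m}"
    using D(1) by (fastforce simp: four_cycle_decomposition_def cocktail_party_edges_def
        complete_edges_def)
  then show ?thesis
    using four_cycle_decomposition_image[OF D(1) inj standard_factor_subset]
      uniquely_colourable_image[OF D(2) inj] f(2) V by auto
qed

end
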